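(* If any three real symmetric surfaces in $\mathbb{P}^3_{\mathbb{C}}$ intersect transversely, then the number of real points in their intersection is a multiple of $12$.
   Context: A real symmetric surface is a hypersurface $V(f) \subseteq \mathbb{P}^3_{\mathbb{C}}$ defined by a nonzero homogeneous polynomial $f$ of degree at least $1$ in four variables, with real coefficients, invariant under all permutations of the four variables. Three surfaces $V(f_1), V(f_2), V(f_3)$ intersect transversely if at every point of the common zero set $V(f_1,f_2,f_3) \subseteq \mathbb{P}^3_{\mathbb{C}}$ the intersection multiplicity is $1$, equivalently the Jacobian matrix of the (dehomogenized) $f_i$ in an affine chart around the point is invertible there. A real point is a point that admits homogeneous coordinates all of which are real. *)

theory Defs
  imports "HOL-Analysis.Analysis" "HOL-Library.Poly_Mapping"
begin

(* Real polynomials in variables indexed by 'v: a finitely supported map from exponent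
   vectors to coefficients. *)
type_synonym 'v real_mpoly = "('v \<Rightarrow>\<^sub>0 nat) \<Rightarrow>\<^sub>0 real"

definition eval_mpoly :: "'v::finite real_mpoly \<Rightarrow> complex ^ 'v \<Rightarrow> complex" where
  "eval_mpoly f x =
     (\<Sum>m\<in>Poly_Mapping.keys f.
        complex_of_real (Poly_Mapping.lookup f m) * (\<Prod>i\<in>UNIV. (x $ i) ^ Poly_Mapping.lookup m i))"

definition homogeneous_mpoly :: "nat \<Rightarrow> 'v::finite real_mpoly \<Rightarrow> bool" where
  "homogeneous_mpoly d f \<longleftrightarrow>
     (\<forall>m\<in>Poly_Mapping.keys f. (\<Sum>i\<in>UNIV. Poly_Mapping.lookup m i) = d)"

(* For a bijection p, the exponent vector map_key p m is i \<mapsto> m (p i); thus f is invariant under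
   a permutation of the variables iff its coefficients are invariant under reindexing. *)
definition symmetric_mpoly :: "'v real_mpoly \<Rightarrow> bool" where
  "symmetric_mpoly f \<longleftrightarrow>
     (\<forall>p :: 'v \<Rightarrow> 'v. bij p \<longrightarrow>
        (\<forall>m. Poly_Mapping.lookup f (Poly_Mapping.map_key p m) = Poly_Mapping.lookup f m))"

(* The surface V(f) is represented by its equation f, since transversality depends on the
   equation and not only on the zero set. *)
definition real_symmetric_surface :: "4 real_mpoly \<Rightarrow> bool" where
  "real_symmetric_surface f \<longleftrightarrow>
     f \<noteq> 0 \<and> (\<exists>d\<ge>1. homogeneous_mpoly d f) \<and> symmetric_mpoly f"

(* A point of complex projective 3-space is the set of all its vectors of homogeneous
   coordinates. *)
definition proj_rel :: "((complex ^ 4) \<times> (complex ^ 4)) set" where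
  "proj_rel = {(x, y). x \<noteq> 0 \<and> y \<noteq> 0 \<and> (\<exists>c. c \<noteq> 0 \<and> y = c *s x)}"

definition proj_space :: "(complex ^ 4) set set" where
  "proj_space = (UNIV - {0}) // proj_rel"

definition common_zeros :: "(3 \<Rightarrow> 4 real_mpoly) \<Rightarrow> (complex ^ 4) set set" where
  "common_zeros f = {P \<in> proj_space. \<forall>x\<in>P. \<forall>i. eval_mpoly (f i) x = 0}"

definition real_point :: "(complex ^ 4) set \<Rightarrow> bool" where
  "real_point P \<longleftrightarrow> (\<exists>x\<in>P. \<forall>i. x $ i \<in> \<real>)"

(* An injection s from 3 to 4 misses exactly one index k and so describes the affine chart
   x_k = 1, with affine coordinates y_j = x_(s j). *)
definition affine_chart :: "(3 \<Rightarrow> 4) \<Rightarrow> complex ^ 3 \<Rightarrow> complex ^ 4" where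
  "affine_chart s y = (\<chi> i. if i \<in> range s then y $ (inv s i) else 1)"

definition dehomogenize :: "(3 \<Rightarrow> 4) \<Rightarrow> 4 real_mpoly \<Rightarrow> complex ^ 3 \<Rightarrow> complex" where
  "dehomogenize s f y = eval_mpoly f (affine_chart s y)"

definition chart_jacobian :: "(3 \<Rightarrow> 4) \<Rightarrow> (3 \<Rightarrow> 4 real_mpoly) \<Rightarrow> complex ^ 3 \<Rightarrow> complex ^ 3 ^ 3" where
  "chart_jacobian s f y =
     (\<chi> i j. deriv (\<lambda>t. dehomogenize s (f i) (y + t *s axis j 1)) 0)"

(* Invertibility of the Jacobian does not depend on the chosen chart around the point. *)
definition intersect_transversely :: "(3 \<Rightarrow> 4 real_mpoly) \<Rightarrow> bool" where
  "intersect_transversely f \<longleftrightarrow>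
     (\<forall>P\<in>common_zeros f. \<exists>s y. inj s \<and> affine_chart s y \<in> P \<and> invertible (chart_jacobian s f y))"

end

theory Submission imports Defs begin

text \<open>At a common zero \<open>x\<close>, Euler's relation and transversality show that the gradients of the
  three homogeneous polynomials have exactly the line through \<open>x\<close> as common kernel. If two
  coordinates \<open>x\<^sub>i = x\<^sub>j\<close> agreed, symmetry would put \<open>e\<^sub>i - e\<^sub>j\<close> into this kernel although it is
  not a multiple of \<open>x\<close>; hence the coordinates of \<open>x\<close> are pairwise distinct. So the permutations of
  the coordinates act freely on the set \<open>S\<close> of real common zeros of norm \<open>1\<close>. This set is compact,
  and it is discrete because the kernel of the gradients is transverse to the sphere, so it is finite
  and \<open>24\<close> divides its cardinality. Every real point has exactly two representatives \<open>\<plusminus>x\<close> in \<open>S\<close>.\<close>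

section \<open>Derivatives of homogeneous and symmetric polynomials\<close>

text \<open>The formal partial derivatives. When \<open>lookup m i\<close> is \<open>0\<close> the
  truncated exponent \<open>lookup m i - 1\<close> is also \<open>0\<close>, but the factor
  \<open>of_nat (lookup m i)\<close> then removes the term.\<close>

definition mpoly_gradient :: "'v::finite real_mpoly \<Rightarrow> complex ^ 'v \<Rightarrow> complex ^ 'v" where
  "mpoly_gradient f x = (\<chi> i. \<Sum>m\<in>Poly_Mapping.keys f.
     complex_of_real (Poly_Mapping.lookup f m) *
       (of_nat (Poly_Mapping.lookup m i) * (x $ i) ^ (Poly_Mapping.lookup m i - 1) *
        (\<Prod>j\<in>UNIV - {i}. (x $ j) ^ Poly_Mapping.lookup m j)))"

lemma eval_mpoly_has_derivative:
  "(eval_mpoly f has_derivative (\<lambda>v. \<Sum>i\<in>UNIV. mpoly_gradient f x $ i * v $ i)) (at x)"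
proof -
  have nth: "((\<lambda>x. x $ i) has_derivative (\<lambda>v. v $ i)) (at x)" for i
    by (rule bounded_linear.has_derivative[OF bounded_linear_vec_nth has_derivative_ident])
  have "(eval_mpoly f has_derivative (\<lambda>v. \<Sum>m\<in>Poly_Mapping.keys f.
     complex_of_real (Poly_Mapping.lookup f m) *
       (\<Sum>i\<in>UNIV. of_nat (Poly_Mapping.lookup m i) * v $ i * (x $ i) ^ (Poly_Mapping.lookup m i - 1) *
        (\<Prod>j\<in>UNIV - {i}. (x $ j) ^ Poly_Mapping.lookup m j)))) (at x)"
    unfolding eval_mpoly_def[abs_def]
    by (intro has_derivative_sum has_derivative_mult_right has_derivative_prod
        has_derivative_power nth)
  also have "(\<lambda>v. \<Sum>m\<in>Poly_Mapping.keys f.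
     complex_of_real (Poly_Mapping.lookup f m) *
       (\<Sum>i\<in>UNIV. of_nat (Poly_Mapping.lookup m i) * v $ i * (x $ i) ^ (Poly_Mapping.lookup m i - 1) *
        (\<Prod>j\<in>UNIV - {i}. (x $ j) ^ Poly_Mapping.lookup m j))) =
     (\<lambda>v. \<Sum>i\<in>UNIV. mpoly_gradient f x $ i * v $ i)"
    unfolding mpoly_gradient_def vec_lambda_beta sum_distrib_left sum_distrib_right
    by (subst sum.swap) (simp add: mult_ac)
  finally show ?thesis .
qed

text \<open>The real derivative along a line is complex linear in the parameter, hence a complex
  derivative. This matches the \<open>deriv\<close> in \<open>chart_jacobian\<close>, and its
  uniqueness turns functional equations of \<open>f\<close> into identities for the
  gradient.\<close>

lemma eval_mpoly_has_directional_derivative: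
  "((\<lambda>t. eval_mpoly f (x + t *s v)) has_field_derivative
     (\<Sum>i\<in>UNIV. mpoly_gradient f x $ i * v $ i)) (at 0)"
proof -
  have "bounded_linear (\<lambda>t. t *s v)"
    by (rule linear_conv_bounded_linear[THEN iffD1], rule linearI)
      (auto simp: vec_eq_iff algebra_simps)
  then have "((\<lambda>t. x + t *s v) has_derivative (\<lambda>t. t *s v)) (at 0)"
    using has_derivative_add[OF has_derivative_const bounded_linear_imp_has_derivative] by force
  moreover have "(eval_mpoly f has_derivative (\<lambda>v. \<Sum>i\<in>UNIV. mpoly_gradient f x $ i * v $ i))
      (at (x + 0 *s v))"
    by (simp add: eval_mpoly_has_derivative)
  ultimately have "((\<lambda>t. eval_mpoly f (x + t *s v)) has_derivative
      (\<lambda>t. \<Sum>i\<in>UNIV. mpoly_gradient f x $ i * (t *s v) $ i)) (at 0)"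
    by (rule has_derivative_compose)
  then show ?thesis
    by (rule has_derivative_imp_has_field_derivative) (simp add: sum_distrib_left mult_ac)
qed

lemma eval_mpoly_scale:
  assumes "homogeneous_mpoly d f"
  shows "eval_mpoly f (c *s x) = c ^ d * eval_mpoly f x"
  unfolding eval_mpoly_def sum_distrib_left
proof (rule sum.cong[OF refl])
  fix m assume "m \<in> Poly_Mapping.keys f"
  then have "(\<Sum>i\<in>UNIV. Poly_Mapping.lookup m i) = d"
    using assms by (auto simp: homogeneous_mpoly_def)
  then show "complex_of_real (Poly_Mapping.lookup f m) *
      (\<Prod>i\<in>UNIV. ((c *s x) $ i) ^ Poly_Mapping.lookup m i) =
      c ^ d * (complex_of_real (Poly_Mapping.lookup f m) *
      (\<Prod>i\<in>UNIV. (x $ i) ^ Poly_Mapping.lookup m i))"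
    by (simp add: power_mult_distrib prod.distrib power_sum[symmetric])
qed

text \<open>Permuting the coordinates by \<open>p\<close> acts on exponent vectors by
  \<open>inv p\<close>; this permutes the monomials of \<open>f\<close> and preserves their
  coefficients.\<close>

lemma eval_mpoly_permute:
  assumes "symmetric_mpoly f" "bij p"
  shows "eval_mpoly f (\<chi> i. x $ p i) = eval_mpoly f x"
proof -
  have inv: "bij (inv p)" using assms(2) by (rule bij_imp_bij_inv)
  have inj: "inj p" "inj (inv p)"
    using assms(2) inv by (auto simp: bij_is_inj)
  have coeff: "Poly_Mapping.lookup f (Poly_Mapping.map_key q m) = Poly_Mapping.lookup f m"
    if "bij q" for q m
    using assms(1) that by (auto simp: symmetric_mpoly_def)
  have keys: "Poly_Mapping.map_key q m \<in> Poly_Mapping.keys f"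
    if "bij q" "m \<in> Poly_Mapping.keys f" for q m
    using that by (simp add: in_keys_iff coeff)
  have cancel: "Poly_Mapping.map_key p (Poly_Mapping.map_key (inv p) m) = m"
    "Poly_Mapping.map_key (inv p) (Poly_Mapping.map_key p m) = m" for m :: "'a \<Rightarrow>\<^sub>0 nat"
    using inj assms(2)
    by (simp_all add: map_key_compose o_def bij_is_surj surj_f_inv_f map_key_id)
  show ?thesis
    unfolding eval_mpoly_def
  proof (rule sum.reindex_bij_witness[of _ "Poly_Mapping.map_key p" "Poly_Mapping.map_key (inv p)"])
    fix m assume "m \<in> Poly_Mapping.keys f"
    have "(\<Prod>i\<in>UNIV. (x $ i) ^ Poly_Mapping.lookup (Poly_Mapping.map_key (inv p) m) i) =
        (\<Prod>i\<in>UNIV. (x $ p i) ^ Poly_Mapping.lookup m i)"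
      by (rule prod.reindex_bij_witness[of _ p "inv p"])
        (use assms(2) inj in \<open>auto simp: map_key.rep_eq bij_is_surj surj_f_inv_f\<close>)
    then show "complex_of_real (Poly_Mapping.lookup f (Poly_Mapping.map_key (inv p) m)) *
        (\<Prod>i\<in>UNIV. (x $ i) ^ Poly_Mapping.lookup (Poly_Mapping.map_key (inv p) m) i) =
        complex_of_real (Poly_Mapping.lookup f m) *
        (\<Prod>i\<in>UNIV. ((\<chi> i. x $ p i) $ i) ^ Poly_Mapping.lookup m i)"
      by (simp add: coeff inv)
  qed (use assms(2) inv in \<open>simp_all add: cancel keys\<close>)
qed

text \<open>Both sides are the derivative at \<open>t = 0\<close> of f(cx + tcv) = c^d f(x + tv).
  Keeping the factor \<open>c\<close> on the left avoids the exponent d - 1. For nonzero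
  \<open>c\<close> the gradients at \<open>x\<close> and \<open>c *s x\<close> have the same
  kernel.\<close>

lemma mpoly_gradient_scale:
  assumes "homogeneous_mpoly d f"
  shows "c * (\<Sum>i\<in>UNIV. mpoly_gradient f (c *s x) $ i * v $ i) =
    c ^ d * (\<Sum>i\<in>UNIV. mpoly_gradient f x $ i * v $ i)"
proof (rule DERIV_unique)
  have "c *s x + t *s (c *s v) = c *s (x + t *s v)" for t
    by (simp add: vec_eq_iff algebra_simps)
  then have "(\<lambda>t. eval_mpoly f (c *s x + t *s (c *s v))) = (\<lambda>t. c ^ d * eval_mpoly f (x + t *s v))"
    by (simp only: eval_mpoly_scale[OF assms])
  then show "((\<lambda>t. c ^ d * eval_mpoly f (x + t *s v)) has_field_derivative
      c * (\<Sum>i\<in>UNIV. mpoly_gradient f (c *s x) $ i * v $ i)) (at 0)"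
    using eval_mpoly_has_directional_derivative[of f "c *s x" "c *s v"]
    by (simp add: sum_distrib_left mult_ac)
  show "((\<lambda>t. c ^ d * eval_mpoly f (x + t *s v)) has_field_derivative
      c ^ d * (\<Sum>i\<in>UNIV. mpoly_gradient f x $ i * v $ i)) (at 0)"
    by (rule DERIV_cmult[OF eval_mpoly_has_directional_derivative])
qed

text \<open>Euler's relation at a zero: by homogeneity \<open>f\<close> vanishes on the whole line
  (1 + t)x.\<close>

lemma mpoly_gradient_radial:
  assumes "homogeneous_mpoly d f" "eval_mpoly f x = 0"
  shows "(\<Sum>i\<in>UNIV. mpoly_gradient f x $ i * x $ i) = 0"
proof -
  have "eval_mpoly f (x + t *s x) = 0" for t
  proof -
    have "x + t *s x = (1 + t) *s x"
      by (simp add: vec_eq_iff algebra_simps)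
    then show ?thesis
      by (simp only: eval_mpoly_scale[OF assms(1)] assms(2) mult_zero_right)
  qed
  then have "((\<lambda>t::complex. 0) has_field_derivative
      (\<Sum>i\<in>UNIV. mpoly_gradient f x $ i * x $ i)) (at 0)"
    using eval_mpoly_has_directional_derivative[of f x x] by simp
  then show ?thesis
    using DERIV_const DERIV_unique by blast
qed

text \<open>The transposition of the two coordinates fixes the point and reverses the direction, so the
  restriction of the polynomial to this line is an even function.\<close>
lemma mpoly_gradient_axis_diff:
  fixes x :: "complex ^ 'v::finite"
  assumes "symmetric_mpoly f" "x $ i = x $ j"
  shows "(\<Sum>k\<in>UNIV. mpoly_gradient f x $ k * (axis i 1 - axis j 1) $ k) = 0"
    (is "?D = 0")
proof -
  define v :: "complex ^ 'v" where "v = axis i 1 - axis j 1"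
  define h where "h t = eval_mpoly f (x + t *s v)" for t
  have even: "h (- t) = h t" for t
  proof -
    have "(\<chi> k. (x + t *s v) $ (Transposition.transpose i j k)) = x + (- t) *s v"
      using assms(2) by (auto simp: vec_eq_iff v_def axis_def Transposition.transpose_def)
    then show ?thesis
      unfolding h_def
      using eval_mpoly_permute[OF assms(1), of "Transposition.transpose i j" "x + t *s v"] by simp
  qed
  have D: "(h has_field_derivative ?D) (at 0)"
    unfolding h_def v_def by (rule eval_mpoly_has_directional_derivative)
  have "((\<lambda>t. h (- t)) has_field_derivative ?D * - 1) (at 0)"
    by (rule DERIV_chain2[where g = uminus]) (use D in \<open>auto intro!: derivative_eq_intros\<close>)
  with D have "?D = ?D * - 1"
    unfolding even by (rule DERIV_unique)
  then show ?thesis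
    by (simp only: mult_minus_right mult_1_right eq_neg_iff_add_eq_0 flip: mult_2) simp
qed

section \<open>Jacobians in affine charts\<close>

lemma affine_chart_add:
  assumes "inj s"
  shows "affine_chart s (y + t *s axis j 1) = affine_chart s y + t *s axis (s j) 1"
  using assms by (auto simp: affine_chart_def vec_eq_iff axis_def)

text \<open>The \<open>j\<close>-th affine coordinate is the homogeneous coordinate
  \<open>s j\<close>, so the chart Jacobian is the 3 by 4 matrix of gradients with the column
  outside \<open>range s\<close> deleted.\<close>

lemma chart_jacobian_eq:
  assumes "inj s"
  shows "chart_jacobian s f y $ i $ j = mpoly_gradient (f i) (affine_chart s y) $ s j"
proof -
  have "(\<Sum>k\<in>UNIV. mpoly_gradient (f i) x $ k * axis (s j) 1 $ k) = mpoly_gradient (f i) x $ s j" for x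
    by (simp add: axis_def if_distrib cong: if_cong)
  then show ?thesis
    unfolding chart_jacobian_def dehomogenize_def affine_chart_add[OF assms]
    using DERIV_imp_deriv[OF eval_mpoly_has_directional_derivative[of "f i" "affine_chart s y" "axis (s j) 1"]]
    by simp
qed

lemma injective_chart_range:
  fixes s :: "3 \<Rightarrow> 4"
  assumes "inj s"
  obtains k where "- range s = {k}"
proof -
  have "card (- range s) = 1"
    using card_image[OF assms] by (simp add: Compl_eq_Diff_UNIV card_Diff_subset)
  then show ?thesis
    using that by (auto simp: card_1_singleton_iff)
qed

text \<open>Modulo the point itself, which lies in the kernel by \<open>euler\<close>, a kernel
  vector can be given a zero in the coordinate that the chart fixes to 1. Its other three
  coordinates are then killed by the invertible Jacobian.\<close>

lemma gradient_kernel_affine_chart: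
  assumes "inj s" "invertible (chart_jacobian s f y)"
    and euler: "\<And>i. (\<Sum>k\<in>UNIV. mpoly_gradient (f i) (affine_chart s y) $ k * affine_chart s y $ k) = 0"
    and v: "\<And>i. (\<Sum>k\<in>UNIV. mpoly_gradient (f i) (affine_chart s y) $ k * v $ k) = 0"
  shows "\<exists>c. v = c *s affine_chart s y"
proof -
  define z where "z = affine_chart s y"
  obtain k where k: "- range s = {k}"
    using injective_chart_range[OF assms(1)] .
  \<comment> \<open>Since \<open>z $ k = 1\<close>, this subtraction clears coordinate
    \<open>k\<close>.\<close>
  define w where "w = v - (v $ k) *s z"
  have wk: "w $ k = 0"
    using k by (auto simp: w_def z_def affine_chart_def)
  have w: "(\<Sum>l\<in>UNIV. mpoly_gradient (f i) z $ l * w $ l) = 0" for i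
  proof -
    have "(\<Sum>l\<in>UNIV. mpoly_gradient (f i) z $ l * w $ l) =
      (\<Sum>l\<in>UNIV. mpoly_gradient (f i) z $ l * v $ l) -
      v $ k * (\<Sum>l\<in>UNIV. mpoly_gradient (f i) z $ l * z $ l)"
      by (simp add: w_def sum_subtractf sum_distrib_left algebra_simps)
    then show ?thesis
      using v euler by (simp add: z_def)
  qed
  have "chart_jacobian s f y *v (\<chi> j. w $ s j) = 0"
  proof -
    have "(chart_jacobian s f y *v (\<chi> j. w $ s j)) $ i = 0" for i
    proof -
      have "(chart_jacobian s f y *v (\<chi> j. w $ s j)) $ i =
          (\<Sum>j\<in>UNIV. mpoly_gradient (f i) z $ s j * w $ s j)"
        by (simp add: matrix_vector_mult_def chart_jacobian_eq[OF assms(1)] z_def)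
      also have "\<dots> = (\<Sum>l\<in>range s. mpoly_gradient (f i) z $ l * w $ l)"
        using assms(1) by (simp add: sum.reindex)
      \<comment> \<open>The only index added is \<open>k\<close>, where \<open>w\<close>
        vanishes.\<close>
      also have "\<dots> = (\<Sum>l\<in>UNIV. mpoly_gradient (f i) z $ l * w $ l)"
        by (rule sum.mono_neutral_left) (use k wk in auto)
      finally show ?thesis by (simp add: w)
    qed
    then show ?thesis by (simp add: vec_eq_iff)
  qed
  then have "(\<chi> j. w $ s j) = 0"
    using assms(2) by (metis invertible_left_inverse matrix_left_invertible_ker)
  then have "w $ s j = 0" for j
    by (simp add: vec_eq_iff)
  then have "w = 0"
    using k wk by (auto simp: vec_eq_iff) (metis ComplI rangeE singletonD)
  then show ?thesis
    by (auto simp: w_def z_def)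
qed

section \<open>Projective classes, real vectors and isolated points\<close>

lemma equiv_proj_rel: "equiv (UNIV - {0}) proj_rel"
proof (rule equivI)
  show "refl_on (UNIV - {0}) proj_rel"
    by (auto simp: refl_on_def proj_rel_def intro!: exI[of _ 1])
  show "sym proj_rel"
  proof (rule symI)
    fix x y assume "(x, y) \<in> proj_rel"
    then obtain c where "x \<noteq> 0" "y \<noteq> 0" "c \<noteq> 0" "y = c *s x"
      by (auto simp: proj_rel_def)
    then show "(y, x) \<in> proj_rel"
      by (auto simp: proj_rel_def intro!: exI[of _ "inverse c"])
  qed
  show "trans proj_rel"
  proof (rule transI)
    fix x y z assume "(x, y) \<in> proj_rel" "(y, z) \<in> proj_rel"
    then show "(x, z) \<in> proj_rel"
      by (auto simp: proj_rel_def)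
  qed
qed (auto simp: proj_rel_def)

abbreviation cvec :: "real ^ 'n \<Rightarrow> complex ^ 'n" where
  "cvec x \<equiv> (\<chi> i. complex_of_real (x $ i))"

lemma cvec_eq_0_iff: "cvec x = 0 \<longleftrightarrow> x = 0"
  by (simp add: vec_eq_iff)

lemma bounded_linear_cvec: "bounded_linear (cvec :: real ^ 'n \<Rightarrow> complex ^ 'n)"
  by (rule linear_conv_bounded_linear[THEN iffD1], rule linearI)
    (auto simp: vec_eq_iff scaleR_conv_of_real[where 'a = complex])

lemma eval_mpoly_cvec_has_derivative:
  "((\<lambda>y. eval_mpoly f (cvec y)) has_derivative
    (\<lambda>v. \<Sum>k\<in>UNIV. mpoly_gradient f (cvec x) $ k * cvec v $ k)) (at x)"
  by (rule has_derivative_compose[OF bounded_linear_imp_has_derivative[OF bounded_linear_cvec]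
        eval_mpoly_has_derivative])

definition real_unit_zeros :: "(3 \<Rightarrow> 4 real_mpoly) \<Rightarrow> (real ^ 4) set" where
  "real_unit_zeros f = {x. norm x = 1 \<and> (\<forall>i. eval_mpoly (f i) (cvec x) = 0)}"

text \<open>An injective linear map satisfies |F' v| \<ge> B|v| with B > 0. If
  \<open>F y = F x\<close>, the error of the linear approximation would be at least B|y - x|, which
  is impossible near \<open>x\<close>. The target may have larger dimension than the source, as in
  the application to a map from R^4 to C^3 x R.\<close>

lemma has_derivative_inj_imp_isolated:
  fixes F :: "'a::euclidean_space \<Rightarrow> 'b::euclidean_space"
  assumes "(F has_derivative F') (at x)" "inj F'"
  shows "\<forall>\<^sub>F y in at x. F y \<noteq> F x"
proof -
  have lin: "linear F'"
    using assms(1) has_derivative_linear by blast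
  obtain B where B: "B > 0" "\<And>v. B * norm v \<le> norm (F' v)"
    using linear_inj_bounded_below_pos[OF lin assms(2)] by blast
  have "((\<lambda>y. norm (F y - F x - F' (y - x)) / norm (y - x)) \<longlongrightarrow> 0) (at x)"
    using assms(1) by (simp add: has_derivative_iff_norm)
  then have "\<forall>\<^sub>F y in at x. norm (F y - F x - F' (y - x)) / norm (y - x) < B"
    using B(1) by (rule order_tendstoD)
  moreover have "\<forall>\<^sub>F y in at x. y \<noteq> x"
    by (auto simp: eventually_at_filter)
  ultimately show ?thesis
  proof eventually_elim
    case (elim y)
    show ?case
    proof
      assume "F y = F x"
      then have "norm (F' (y - x)) < B * norm (y - x)"
        using elim by (simp add: divide_less_eq)
      with B(2)[of "y - x"] show False by simp
    qed
  qed
qed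

lemma has_derivative_vec_lambda:
  fixes F :: "'i::finite \<Rightarrow> 'a::real_normed_vector \<Rightarrow> 'b::euclidean_space"
  assumes "\<And>i. (F i has_derivative F' i) (at x)"
  shows "((\<lambda>y. \<chi> i. F i y) has_derivative (\<lambda>v. \<chi> i. F' i v)) (at x)"
proof (subst has_derivative_componentwise_within, rule ballI)
  fix b :: "'b ^ 'i" assume "b \<in> Basis"
  then obtain i u where b: "b = axis i u"
    by (auto simp: Basis_vec_def)
  show "((\<lambda>y. (\<chi> i. F i y) \<bullet> b) has_derivative (\<lambda>v. (\<chi> i. F' i v) \<bullet> b)) (at x)"
    unfolding b inner_axis by (simp add: has_derivative_inner_left[OF assms])
qed

section \<open>Common zeros of three transverse symmetric surfaces\<close>

context
  fixes f :: "3 \<Rightarrow> 4 real_mpoly"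
  assumes surface: "\<And>i. real_symmetric_surface (f i)"
    and transverse: "intersect_transversely f"
begin

lemma symmetric: "symmetric_mpoly (f i)"
  using surface by (auto simp: real_symmetric_surface_def)

lemma eval_scale_eq_0:
  assumes "eval_mpoly (f i) x = 0"
  shows "eval_mpoly (f i) (c *s x) = 0"
  using surface[of i] assms by (auto simp: real_symmetric_surface_def eval_mpoly_scale)

lemma proj_class_in_common_zeros:
  assumes "x \<noteq> 0" "\<And>i. eval_mpoly (f i) x = 0"
  shows "proj_rel `` {x} \<in> common_zeros f"
  using assms eval_scale_eq_0
  by (auto simp: common_zeros_def proj_space_def quotient_def proj_rel_def)

text \<open>Transversality speaks of one representative in one chart. It is a nonzero multiple of
  \<open>x\<close>, so \<open>mpoly_gradient_scale\<close> carries \<open>v\<close> into the kernel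
  there, and both points span the same line.\<close>

lemma gradient_kernel:
  assumes "x \<noteq> 0" "\<And>i. eval_mpoly (f i) x = 0"
    and v: "\<And>i. (\<Sum>k\<in>UNIV. mpoly_gradient (f i) x $ k * v $ k) = 0"
  shows "\<exists>c. v = c *s x"
proof -
  have "proj_rel `` {x} \<in> common_zeros f"
    using assms(1,2) by (rule proj_class_in_common_zeros)
  then obtain s y where sy: "inj s" "affine_chart s y \<in> proj_rel `` {x}"
      "invertible (chart_jacobian s f y)"
    using transverse unfolding intersect_transversely_def by blast
  from sy(2) obtain c where c: "c \<noteq> 0" "affine_chart s y = c *s x"
    by (auto simp: proj_rel_def)
  have zero: "eval_mpoly (f i) (affine_chart s y) = 0" for i
    unfolding c(2) by (rule eval_scale_eq_0[OF assms(2)])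
  have "\<exists>a. v = a *s affine_chart s y"
  proof (rule gradient_kernel_affine_chart[OF sy(1,3)])
    fix i
    obtain d where d: "homogeneous_mpoly d (f i)"
      using surface[of i] by (auto simp: real_symmetric_surface_def)
    show "(\<Sum>k\<in>UNIV. mpoly_gradient (f i) (affine_chart s y) $ k * affine_chart s y $ k) = 0"
      using d zero by (rule mpoly_gradient_radial)
    show "(\<Sum>k\<in>UNIV. mpoly_gradient (f i) (affine_chart s y) $ k * v $ k) = 0"
      using mpoly_gradient_scale[OF d, of c x v] v[of i] c by simp
  qed
  then show ?thesis
    unfolding c(2) by auto
qed

lemma inj_coordinates:
  assumes "x \<noteq> 0" "\<And>i. eval_mpoly (f i) x = 0"
  shows "inj (($) x)"
proof (rule injI, rule ccontr)
  fix i j assume eq: "x $ i = x $ j" and "i \<noteq> j"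
  obtain c where c: "axis i 1 - axis j 1 = c *s x"
    using gradient_kernel[OF assms mpoly_gradient_axis_diff[OF symmetric eq]] by blast
  \<comment> \<open>A multiple of \<open>x\<close> has equal entries at \<open>i\<close> and
    \<open>j\<close>, whereas these entries are 1 and -1.\<close>
  have "(axis i 1 - axis j 1 :: complex ^ 4) $ i = (axis i 1 - axis j 1 :: complex ^ 4) $ j"
    unfolding c by (simp add: eq)
  with \<open>i \<noteq> j\<close> show False
    by (simp add: axis_def)
qed

lemma real_unit_zeros_isolated:
  assumes "x \<in> real_unit_zeros f"
  shows "\<not> x islimpt real_unit_zeros f"
proof -
  \<comment> \<open>The equations alone leave the radial direction in the kernel of the derivative;
    the extra component \<open>y \<bullet> y\<close>, constant on the sphere, removes it.\<close>
  define F where "F y = ((\<chi> i. eval_mpoly (f i) (cvec y)), y \<bullet> y)" for y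
  define F' where "F' v =
    ((\<chi> i. \<Sum>k\<in>UNIV. mpoly_gradient (f i) (cvec x) $ k * cvec v $ k) :: complex ^ 3, 2 * (x \<bullet> v))" for v
  have x: "norm x = 1" "\<And>i. eval_mpoly (f i) (cvec x) = 0" "cvec x \<noteq> 0"
    using assms by (auto simp: real_unit_zeros_def cvec_eq_0_iff)
  have "((\<lambda>y. \<chi> i. eval_mpoly (f i) (cvec y)) has_derivative
      (\<lambda>v. (\<chi> i. \<Sum>k\<in>UNIV. mpoly_gradient (f i) (cvec x) $ k * cvec v $ k))) (at x)"
    by (rule has_derivative_vec_lambda[OF eval_mpoly_cvec_has_derivative])
  moreover have "((\<lambda>y. y \<bullet> y) has_derivative (\<lambda>v. 2 * (x \<bullet> v))) (at x)"
    by (auto intro!: derivative_eq_intros simp: inner_commute)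
  ultimately have F: "(F has_derivative F') (at x)"
    unfolding F_def F'_def by (rule has_derivative_Pair)
  have "v = 0" if "F' v = 0" for v
  proof -
    have "(\<Sum>k\<in>UNIV. mpoly_gradient (f i) (cvec x) $ k * cvec v $ k) = 0" for i
      using that by (simp add: F'_def zero_prod_def vec_eq_iff)
    then obtain c where c: "cvec v = c *s cvec x"
      using gradient_kernel[OF x(3,2)] by blast
    \<comment> \<open>Both vectors are real, so the real part of the complex scalar already relates
      them.\<close>
    then have "v = Re c *\<^sub>R x"
      by (auto simp: vec_eq_iff complex_eq_iff)
    moreover have "x \<bullet> v = 0"
      using that by (simp add: F'_def zero_prod_def)
    ultimately show ?thesis
      using x(1) by (auto simp: dot_square_norm)
  qed
  then have "inj F'"
    using has_derivative_linear[OF F] by (auto simp: linear_inj_iff_eq_0)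
  then have "\<forall>\<^sub>F y in at x. F y \<noteq> F x"
    using F by (rule has_derivative_inj_imp_isolated[rotated])
  moreover have "F y = F x" if "y \<in> real_unit_zeros f" for y
    using that x by (simp add: F_def real_unit_zeros_def dot_square_norm)
  ultimately show ?thesis
    by (auto simp: islimpt_iff_eventually elim: eventually_mono)
qed

lemma finite_real_unit_zeros: "finite (real_unit_zeros f)"
proof -
  have "continuous_on UNIV (\<lambda>y. eval_mpoly (f i) (cvec y))" for i
    by (intro continuous_at_imp_continuous_on ballI
        has_derivative_continuous[OF eval_mpoly_cvec_has_derivative])
  then have "closed (\<Inter>i. {y. eval_mpoly (f i) (cvec y) = 0})"
    by (intro closed_INT ballI closed_Collect_eq continuous_on_const)
  then have "compact (sphere 0 1 \<inter> (\<Inter>i. {y. eval_mpoly (f i) (cvec y) = 0}))"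
    by (intro compact_Int_closed compact_sphere)
  also have "sphere 0 1 \<inter> (\<Inter>i. {y. eval_mpoly (f i) (cvec y) = 0}) = real_unit_zeros f"
    by (auto simp: real_unit_zeros_def)
  finally show ?thesis
    using finite_not_islimpt_in_compact real_unit_zeros_isolated by fastforce
qed

section \<open>The permutation action on real unit zeros\<close>

lemma real_unit_zeros_permute:
  assumes "x \<in> real_unit_zeros f" "p permutes UNIV"
  shows "(\<chi> i. x $ p i) \<in> real_unit_zeros f"
proof -
  have "norm (\<chi> i. x $ p i) = norm x"
    using sum.permute[OF assms(2), of "\<lambda>i. (x $ i)\<^sup>2"] by (simp add: norm_vec_def L2_set_def o_def)
  moreover have "eval_mpoly (f i) (cvec (\<chi> i. x $ p i)) = eval_mpoly (f i) (cvec x)" for i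
    using eval_mpoly_permute[OF symmetric permutes_bij[OF assms(2)], of i "cvec x"] by simp
  ultimately show ?thesis
    using assms(1) by (simp add: real_unit_zeros_def)
qed

text \<open>The zeros split into the orbits of the coordinate permutations, and each orbit has 4! =
  24 elements.\<close>

lemma card_real_unit_zeros: "24 dvd card (real_unit_zeros f)"
proof (rule equiv_imp_dvd_card[OF finite_real_unit_zeros])
  define r where "r = {(x, y). x \<in> real_unit_zeros f \<and> y \<in> real_unit_zeros f \<and>
    (\<exists>p. p permutes UNIV \<and> y = (\<chi> i. x $ p i))}"
  show "equiv (real_unit_zeros f) r"
  proof (rule equivI)
    show "refl_on (real_unit_zeros f) r"
      by (auto simp: refl_on_def r_def intro!: exI[of _ id] permutes_id)
    show "sym r"
    proof (rule symI)
      fix x y assume "(x, y) \<in> r"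
      then obtain p where "x \<in> real_unit_zeros f" "y \<in> real_unit_zeros f"
          "p permutes UNIV" "y = (\<chi> i. x $ p i)"
        by (auto simp: r_def)
      then show "(y, x) \<in> r"
        by (auto simp: r_def permutes_inverses permutes_inv intro!: exI[of _ "inv p"])
    qed
    show "trans r"
    proof (rule transI)
      fix x y z assume "(x, y) \<in> r" "(y, z) \<in> r"
      then obtain p q where "x \<in> real_unit_zeros f" "z \<in> real_unit_zeros f"
          "p permutes UNIV" "q permutes UNIV" "z = (\<chi> i. x $ p (q i))"
        by (auto simp: r_def)
      then show "(x, z) \<in> r"
        by (auto simp: r_def permutes_compose intro!: exI[of _ "p \<circ> q"])
    qed
  qed (auto simp: r_def)
  fix X assume "X \<in> real_unit_zeros f // r"
  then obtain x where x: "x \<in> real_unit_zeros f" "X = r `` {x}"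
    by (auto simp: quotient_def)
  have "cvec x \<noteq> 0" "\<And>i. eval_mpoly (f i) (cvec x) = 0"
    using x(1) by (auto simp: real_unit_zeros_def cvec_eq_0_iff)
  from inj_coordinates[OF this] have inj: "inj (($) x)"
    by (simp add: inj_def)
  have "X = (\<lambda>p. \<chi> i. x $ p i) ` {p. p permutes UNIV}"
    using x real_unit_zeros_permute by (auto simp: r_def)
  \<comment> \<open>Freeness of the action: as the coordinates of \<open>x\<close> are distinct, the
    value \<open>x $ p i\<close> determines \<open>p i\<close>.\<close>
  moreover have "inj_on (\<lambda>p. \<chi> i. x $ p i) {p. p permutes UNIV}"
    using inj by (auto simp: inj_on_def inj_def vec_eq_iff fun_eq_iff)
  ultimately have "card X = card {p :: 4 \<Rightarrow> 4. p permutes UNIV}"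
    by (simp add: card_image)
  also have "\<dots> = 24"
    by (subst card_permutations[of _ 4]) (simp_all add: fact_numeral)
  finally show "24 dvd card X" by simp
qed

section \<open>From unit vectors to real projective points\<close>

text \<open>Normalizing a real representative gives \<open>x\<close>; a scalar between two real unit
  vectors can only be 1 or -1.\<close>

lemma real_point_unit_representatives:
  assumes "P \<in> common_zeros f" "real_point P"
  obtains x where "x \<noteq> 0" "P = proj_rel `` {cvec x}"
    "{y \<in> real_unit_zeros f. cvec y \<in> P} = {x, - x}"
proof -
  obtain z where z: "z \<in> P" "\<And>i. z $ i \<in> \<real>"
    using assms(2) by (auto simp: real_point_def)
  define w where "w = (\<chi> i. Re (z $ i))"
  have zw: "z = cvec w"
    using z(2) by (simp add: w_def vec_eq_iff)
  obtain u where "u \<noteq> 0" "P = proj_rel `` {u}"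
    using assms(1) by (auto simp: common_zeros_def proj_space_def quotient_def)
  then have P: "P = proj_rel `` {z}" and "z \<noteq> 0"
    using z(1) equiv_class_eq[OF equiv_proj_rel, of u z] by (auto simp: proj_rel_def)
  then have w0: "w \<noteq> 0" by (simp add: zw cvec_eq_0_iff)
  define x where "x = sgn w"
  have x: "norm x = 1" "x \<noteq> 0"
    using w0 by (auto simp: x_def norm_sgn sgn_zero_iff)
  have "(z, cvec x) \<in> proj_rel"
    using w0 x(2) \<open>z \<noteq> 0\<close> unfolding proj_rel_def
    by (auto simp: cvec_eq_0_iff zw x_def sgn_div_norm vec_eq_iff divide_inverse
        intro!: exI[of _ "complex_of_real (inverse (norm w))"])
  then have Px: "P = proj_rel `` {cvec x}"
    using P equiv_class_eq[OF equiv_proj_rel] by blast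
  have zero: "eval_mpoly (f i) u = 0" if "u \<in> P" for u i
    using assms(1) that by (auto simp: common_zeros_def)
  have unit: "y = x \<or> y = - x" if y: "y \<in> real_unit_zeros f" "cvec y \<in> P" for y
  proof -
    obtain c where "cvec y = c *s cvec x"
      using y(2) by (auto simp: Px proj_rel_def)
    then have c: "y = Re c *\<^sub>R x"
      by (auto simp: vec_eq_iff complex_eq_iff)
    then have "\<bar>Re c\<bar> = 1"
      using y(1) x(1) by (simp add: real_unit_zeros_def)
    then show ?thesis using c by (auto simp: abs_if split: if_splits)
  qed
  have in_P: "cvec x \<in> P" "cvec (- x) \<in> P"
    using x(2) unfolding Px proj_rel_def
    by (auto simp: cvec_eq_0_iff intro: exI[of _ "1::complex"])
      (auto simp: vec_eq_iff intro!: exI[of _ "-1::complex"])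
  have "{y \<in> real_unit_zeros f. cvec y \<in> P} = {x, - x}"
    using unit in_P zero[OF in_P(1)] zero[OF in_P(2)] x(1)
    by (auto simp: real_unit_zeros_def)
  with x(2) Px show ?thesis by (rule that)
qed

text \<open>Finiteness is recorded separately because \<open>card\<close> of an infinite set is
  \<open>0\<close>, which every number divides.\<close>

lemma finite_real_points: "finite {P \<in> common_zeros f. real_point P}"
proof (rule finite_subset)
  show "{P \<in> common_zeros f. real_point P} \<subseteq> (\<lambda>x. proj_rel `` {cvec x}) ` real_unit_zeros f"
    using real_point_unit_representatives by blast
qed (simp add: finite_real_unit_zeros)

text \<open>The map from a unit zero to its projective class has the antipodal pairs as fibres;
  distinct classes are disjoint, so the pairs partition the zeros.\<close>

lemma card_real_unit_zeros_eq:
  "card (real_unit_zeros f) = 2 * card {P \<in> common_zeros f. real_point P}" (is "_ = 2 * card ?R")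
proof -
  let ?A = "\<lambda>P. {y \<in> real_unit_zeros f. cvec y \<in> P}"
  have "x \<in> (\<Union>P\<in>?R. ?A P)" if "x \<in> real_unit_zeros f" for x
  proof -
    have x: "cvec x \<noteq> 0" "\<And>i. eval_mpoly (f i) (cvec x) = 0"
      using that by (auto simp: real_unit_zeros_def cvec_eq_0_iff)
    then have "cvec x \<in> proj_rel `` {cvec x}"
      by (auto simp: proj_rel_def intro: exI[of _ 1])
    then show ?thesis
      using that proj_class_in_common_zeros[OF x] by (auto simp: real_point_def intro!: bexI[of _ "proj_rel `` {cvec x}"] bexI[of _ "cvec x"])
  qed
  then have "real_unit_zeros f = (\<Union>P\<in>?R. ?A P)"
    by auto
  also have "card \<dots> = (\<Sum>P\<in>?R. card (?A P))"
  proof (rule card_UN_disjoint[OF finite_real_points])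
    show "\<forall>P\<in>?R. finite (?A P)"
      using finite_real_unit_zeros by simp
    show "\<forall>P\<in>?R. \<forall>Q\<in>?R. P \<noteq> Q \<longrightarrow> ?A P \<inter> ?A Q = {}"
      using quotient_disj[OF equiv_proj_rel] by (auto simp: common_zeros_def proj_space_def)
  qed
  also have "\<dots> = (\<Sum>P\<in>?R. 2)"
  proof (rule sum.cong[OF refl])
    fix P assume "P \<in> ?R"
    then obtain x where "x \<noteq> 0" "?A P = {x, - x}"
      using real_point_unit_representatives by blast
    then show "card (?A P) = 2"
      by (auto simp: card_2_iff vec_eq_iff)
  qed
  finally show ?thesis by simp
qed

end

theorem theorem1p3:
  fixes f :: "3 \<Rightarrow> 4 real_mpoly"
  assumes "\<And>i. real_symmetric_surface (f i)"
    and "intersect_transversely f"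
  shows "finite {P \<in> common_zeros f. real_point P} \<and>
         12 dvd card {P \<in> common_zeros f. real_point P}"
proof
  show "finite {P \<in> common_zeros f. real_point P}"
    using assms by (rule finite_real_points)
  have "24 dvd 2 * card {P \<in> common_zeros f. real_point P}"
    using card_real_unit_zeros[OF assms] card_real_unit_zeros_eq[OF assms] by simp
  then show "12 dvd card {P \<in> common_zeros f. real_point P}"
    by presburger
qed

end
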